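(* Assume that there is a constant $C<\infty$ such that $$\Big\|\int_{\epsilon\le |t|\le R} f(x-t,y-t^2)\, e^{iN_1(x)t+iN_2(x)t^2}\,\frac{dt}{t}\Big\|_{L^2(dx\,dy)}\le C\|f\|_{L^2(\mathbb{R}^2)}$$ for all Schwartz functions $f$ on $\mathbb{R}^2$, all measurable functions $N_1,N_2:\mathbb{R}\to\mathbb{R}$, and all real parameters $0<\epsilon<R$ (so that $C$ is independent of $f,N_1,N_2,\epsilon,R$). Then the operator $$f\longmapsto \mathscr{C}_Q f(x):=\sup_{(N_1,N_2)\in\mathbb{R}^2}\Big|\mathrm{p.v.}\int_{\mathbb{R}} f(x-t)\,e^{iN_1t+iN_2t^2}\,\frac{dt}{t}\Big|$$ is bounded on $L^2(\mathbb{R})$.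
   Context: In the definition of $\mathscr{C}_Q$, $f$ is a function of one real variable and $N_1,N_2$ are real numbers; the operator is initially defined on Schwartz functions. *)

theory Defs
  imports "HOL-Analysis.Analysis"
begin

definition partial_deriv :: "'a::euclidean_space \<Rightarrow> ('a \<Rightarrow> complex) \<Rightarrow> 'a \<Rightarrow> complex"
  where "partial_deriv b f = (\<lambda>x. frechet_derivative f (at x) b)"

(* Complex-valued Schwartz functions on a Euclidean space. A list of basis vectors plays the
   role of a multi-index. Demanding (total) differentiability of every iterated partial
   derivative is smoothness, and it ensures that frechet_derivative is never taken where it
   is unspecified. *)
definition schwartz :: "('a::euclidean_space \<Rightarrow> complex) \<Rightarrow> bool"
  where "schwartz f \<longleftrightarrow>
    (\<forall>bs. set bs \<subseteq> Basis \<longrightarrow>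
       (\<forall>x. foldr partial_deriv bs f differentiable (at x)) \<and>
       (\<forall>k::nat. bounded (range (\<lambda>x. norm x ^ k *\<^sub>R foldr partial_deriv bs f x))))"

(* The L^2 norm of a nonnegative extended-valued function; the value is infinite when the
   function is not square integrable. For complex f, use the function norm (f x). *)
definition L2norm :: "('a::euclidean_space \<Rightarrow> ennreal) \<Rightarrow> ennreal"
  where "L2norm g =
    (let I = (\<integral>\<^sup>+ x. g x ^ 2 \<partial>lborel)
     in if I = \<infinity> then \<infinity> else ennreal (sqrt (enn2real I)))"

abbreviation cL2norm :: "('a::euclidean_space \<Rightarrow> complex) \<Rightarrow> ennreal"
  where "cL2norm f \<equiv> L2norm (\<lambda>x. ennreal (norm (f x)))"

(* Principal value of the integral of h over the line, with respect to the singularity at 0.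
   In the operator below, for Schwartz f, the truncated integrals converge absolutely and the
   limit exists, so that Lim is the genuine limit. *)
definition pv_integral :: "(real \<Rightarrow> complex) \<Rightarrow> complex"
  where "pv_integral h = Lim (at_right 0) (\<lambda>\<epsilon>. LBINT t:{t. \<epsilon> \<le> \<bar>t\<bar>}. h t)"

(* The supremum is taken in [0, \<infinity>], so its finiteness is not presupposed. *)
definition carleson_quad :: "(real \<Rightarrow> complex) \<Rightarrow> real \<Rightarrow> ennreal"
  where "carleson_quad f x =
    (SUP (N\<^sub>1, N\<^sub>2) \<in> (UNIV :: (real \<times> real) set).
       ennreal (norm (pv_integral (\<lambda>t. f (x - t) * exp (\<i> * of_real (N\<^sub>1 * t + N\<^sub>2 * t\<^sup>2)) / of_real t))))"

(* Boundedness on L^2(R) of an operator that is initially defined on Schwartz functions: the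
   a priori estimate on the Schwartz space. Measurability of T f is part of the definition
   because nn_integral of a non-measurable function is only a lower integral. *)
definition bounded_on_L2 :: "((real \<Rightarrow> complex) \<Rightarrow> real \<Rightarrow> ennreal) \<Rightarrow> bool"
  where "bounded_on_L2 T \<longleftrightarrow>
    (\<forall>f. schwartz f \<longrightarrow> T f \<in> borel_measurable borel) \<and>
    (\<exists>C<\<infinity>. \<forall>f. schwartz f \<longrightarrow> L2norm (T f) \<le> C * cL2norm f)"

end

theory Submission
  imports Defs "HOL-Probability.Sinc_Integral"
begin

text \<open>
  The given estimate lives on the plane, where the operator translates along a parabola; the
  wanted one lives on the line. The bridge is a test function that barely notices the second
  coordinate of the translation: \<open>f (x, y) = g x * exp (- (y / s)\<^sup>2)\<close>. After rescaling the
  second variable by \<open>s\<close>, the shift by \<open>t\<^sup>2\<close> becomes a shift by \<open>t\<^sup>2 / s\<close>, which tends to \<open>0\<close> as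
  \<open>s \<rightarrow> \<infinity>\<close> because \<open>t\<close> ranges over a fixed truncation. In the limit the operator acts on
  \<open>g\<close> alone and the Gaussian factors out, so by Fatou's lemma the truncated one-dimensional
  operators with measurable frequencies \<open>N\<^sub>1 (x), N\<^sub>2 (x)\<close> have norm at most \<open>C\<close> on \<open>L\<^sup>2\<close>; this is
  \<open>truncated_L2_bound\<close>.

  It remains to reach the supremum over all frequencies and the limit of full truncation. Let
  \<open>q\<close> enumerate a countable dense set of frequencies. For each \<open>n\<close>, a measurable choice of
  frequency (\<open>measurable_maximizer\<close>) realizes the maximum over \<open>q 0, \<dots>, q n\<close> of the operators
  truncated to \<open>1 / (n + 2) \<le> \<bar>t\<bar> \<le> n + 1\<close>, and that maximum \<open>v n\<close> is bounded on \<open>L\<^sup>2\<close> by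
  \<open>C\<close>. Truncations converge to the principal value (\<open>truncated_tendsto\<close>) and the principal value
  is continuous in the frequencies (\<open>folded_integral_continuous\<close>). So the supremum is at most
  \<open>liminf v\<close> pointwise, and a second use of Fatou's lemma concludes.

  Both facts about the principal value come from folding the integral onto \<open>t > 0\<close>. The folded
  integrand \<open>(g (x - t) e(a t + b t\<^sup>2) - g (x + t) e(- a t + b t\<^sup>2)) / t\<close>, with
  \<open>e(u) = exp (\<i> u)\<close>, is bounded near \<open>0\<close>
  since \<open>g\<close> is Lipschitz, and it is dominated by an integrable function uniformly for bounded
  \<open>a\<close> and arbitrary \<open>b\<close> (\<open>norm_folded_le\<close>).
\<close>

section \<open>Gaussians and tensor products of Schwartz functions\<close>

lemma partial_deriv_has_vector_derivative:
  assumes "(f has_vector_derivative D) (at x)"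
  shows "partial_deriv 1 f x = D"
proof -
  have "(f has_derivative (\<lambda>h. h *\<^sub>R D)) (at x)"
    using assms by (simp add: has_vector_derivative_def)
  from frechet_derivative_at[OF this, symmetric] show ?thesis
    by (simp add: partial_deriv_def)
qed

lemma has_vector_derivative_poly_gaussian:
  "((\<lambda>y. complex_of_real (poly q y * exp (- c * y\<^sup>2))) has_vector_derivative
      complex_of_real (poly (pderiv q - [:0, 2 * c:] * q) y * exp (- c * y\<^sup>2))) (at y)"
proof (rule has_vector_derivative_of_real)
  show "((\<lambda>y. poly q y * exp (- c * y\<^sup>2)) has_real_derivative
      poly (pderiv q - [:0, 2 * c:] * q) y * exp (- c * y\<^sup>2)) (at y)"
    by (auto intro!: derivative_eq_intros simp: algebra_simps power2_eq_square)
qed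

text \<open>
  Functions of the form polynomial times Gaussian are closed under differentiation, since
  \<open>(q e)' = (q' - 2 c y q) e\<close> for \<open>e = exp (- c y\<^sup>2)\<close>.
\<close>
lemma foldr_partial_deriv_poly_gaussian:
  assumes "set bs \<subseteq> (Basis :: real set)"
  shows "\<exists>q. foldr partial_deriv bs (\<lambda>y. complex_of_real (exp (- c * y\<^sup>2)))
             = (\<lambda>y. complex_of_real (poly q y * exp (- c * y\<^sup>2)))"
  using assms
proof (induction bs)
  case Nil
  show ?case by (rule exI[of _ "[:1:]"]) simp
next
  case (Cons b bs)
  then obtain q where q: "foldr partial_deriv bs (\<lambda>y. complex_of_real (exp (- c * y\<^sup>2)))
             = (\<lambda>y. complex_of_real (poly q y * exp (- c * y\<^sup>2)))" and b: "b = 1"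
    by auto
  have "partial_deriv 1 (\<lambda>y. complex_of_real (poly q y * exp (- c * y\<^sup>2))) y
      = complex_of_real (poly (pderiv q - [:0, 2 * c:] * q) y * exp (- c * y\<^sup>2))" for y
    by (intro partial_deriv_has_vector_derivative has_vector_derivative_poly_gaussian)
  then show ?case
    using q b by (intro exI[of _ "pderiv q - [:0, 2 * c:] * q"]) auto
qed

text \<open>
  With \<open>u = c y\<^sup>2\<close>, the bound \<open>u / n \<le> exp (u / n)\<close> gives \<open>u ^ n \<le> n ^ n exp u\<close>; and \<open>\<bar>y\<bar> ^ n\<close> is at
  most \<open>1 + (y\<^sup>2) ^ n\<close>.
\<close>
lemma bounded_range_power_gaussian:
  assumes "c > 0"
  shows "bounded (range (\<lambda>y::real. y ^ n * exp (- c * y\<^sup>2)))"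
proof (rule boundedI)
  fix z assume "z \<in> range (\<lambda>y::real. y ^ n * exp (- c * y\<^sup>2))"
  then obtain y :: real where z: "z = y ^ n * exp (- c * y\<^sup>2)" by auto
  define u where "u = c * y\<^sup>2"
  have u: "0 \<le> u" using assms by (simp add: u_def)
  have "u ^ n \<le> real n ^ n * exp u"
  proof (cases "n = 0")
    case False
    have "u / n \<le> exp (u / n)"
      using exp_ge_add_one_self[of "u / n"] by linarith
    then have "(u / n) ^ n \<le> exp (u / n) ^ n"
      using u by (intro power_mono) auto
    also have "\<dots> = exp u" using False by (simp flip: exp_of_nat_mult)
    finally show ?thesis using False by (simp add: power_divide field_simps)
  qed (use u in simp)
  then have *: "(y\<^sup>2) ^ n * exp (- u) \<le> real n ^ n / c ^ n"
    using assms by (simp add: u_def power_mult_distrib exp_minus field_simps)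
  have "\<bar>y\<bar> ^ n \<le> 1 + (y\<^sup>2) ^ n"
  proof (cases "\<bar>y\<bar> \<le> 1")
    case True
    then have "\<bar>y\<bar> ^ n \<le> 1" by (simp add: power_le_one)
    then show ?thesis by (simp add: add_increasing2)
  next
    case False
    then have "\<bar>y\<bar> ^ n \<le> (\<bar>y\<bar>\<^sup>2) ^ n"
      using mult_right_mono[of 1 "\<bar>y\<bar>" "\<bar>y\<bar>"] by (intro power_mono) (auto simp: power2_eq_square)
    then show ?thesis by simp
  qed
  then have "\<bar>y\<bar> ^ n * exp (- u) \<le> (1 + (y\<^sup>2) ^ n) * exp (- u)"
    by (intro mult_right_mono) auto
  also have "\<dots> = exp (- u) + (y\<^sup>2) ^ n * exp (- u)"
    by (simp add: algebra_simps)
  also have "\<dots> \<le> 1 + real n ^ n / c ^ n"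
    using * u by (intro add_mono) auto
  finally show "norm z \<le> 1 + real n ^ n / c ^ n"
    by (simp add: z u_def abs_mult power_abs)
qed

lemma bounded_range_power_poly_gaussian:
  assumes "c > 0"
  shows "bounded (range (\<lambda>y::real. y ^ k * (poly q y * exp (- c * y\<^sup>2))))"
proof -
  have "y ^ k * (poly q y * exp (- c * y\<^sup>2))
      = (\<Sum>i\<le>degree q. coeff q i * (y ^ (k + i) * exp (- c * y\<^sup>2)))" for y :: real
    by (simp add: poly_altdef sum_distrib_left sum_distrib_right power_add mult_ac)
  moreover have "bounded (range (\<lambda>y::real. \<Sum>i\<in>I. coeff q i * (y ^ (k + i) * exp (- c * y\<^sup>2))))"
    if "finite I" for I
    using that
  proof (induction I rule: finite_induct)
    case (insert i I)
    have "bounded (range (\<lambda>y::real. coeff q i * (y ^ (k + i) * exp (- c * y\<^sup>2))))"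
      using bounded_scaling[OF bounded_range_power_gaussian[OF assms, of "k + i"], of "coeff q i"]
      by (simp add: image_image)
    from bounded_plus_comp[OF this insert.IH] insert.hyps show ?case by simp
  qed simp
  ultimately show ?thesis by simp
qed

lemma schwartz_gaussian:
  assumes "c > 0"
  shows "schwartz (\<lambda>y::real. complex_of_real (exp (- c * y\<^sup>2)))"
  unfolding schwartz_def
proof (intro allI impI conjI)
  fix bs :: "real list" and x :: real and k :: nat
  assume bs: "set bs \<subseteq> Basis"
  from foldr_partial_deriv_poly_gaussian[OF bs] obtain q
    where q: "foldr partial_deriv bs (\<lambda>y. complex_of_real (exp (- c * y\<^sup>2)))
             = (\<lambda>y. complex_of_real (poly q y * exp (- c * y\<^sup>2)))" by blast
  show "foldr partial_deriv bs (\<lambda>y. complex_of_real (exp (- c * y\<^sup>2))) differentiable (at x)"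
    unfolding q by (rule differentiableI_vector[OF has_vector_derivative_poly_gaussian])
  show "bounded (range (\<lambda>x. norm x ^ k *\<^sub>R foldr partial_deriv bs (\<lambda>y. complex_of_real (exp (- c * y\<^sup>2))) x))"
    unfolding q using bounded_range_power_poly_gaussian[OF assms, of k q]
    by (simp add: bounded_iff norm_mult abs_mult power_abs)
qed

text \<open>
  Each coordinate direction differentiates only one factor: the product rule gives two terms, and
  the derivative of the other factor is applied to the increment \<open>0\<close>.
\<close>
lemma partial_deriv_tensor:
  fixes G H :: "real \<Rightarrow> complex"
  assumes "G differentiable (at x)" "H differentiable (at y)"
  shows "partial_deriv (1, 0) (\<lambda>(x, y). G x * H y) (x, y) = partial_deriv 1 G x * H y"
    and "partial_deriv (0, 1) (\<lambda>(x, y). G x * H y) (x, y) = G x * partial_deriv 1 H y"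
    and "(\<lambda>(x, y). G x * H y) differentiable (at (x, y))"
proof -
  let ?G = "frechet_derivative G (at x)" and ?H = "frechet_derivative H (at y)"
  have G: "(G has_derivative ?G) (at x)" and H: "(H has_derivative ?H) (at y)"
    using assms by (simp_all add: frechet_derivative_works)
  have "((\<lambda>z. G (fst z)) has_derivative (\<lambda>v. ?G (fst v))) (at (x, y))"
    by (rule has_derivative_compose[OF has_derivative_fst[OF has_derivative_ident]]) (simp add: G)
  moreover have "((\<lambda>z. H (snd z)) has_derivative (\<lambda>v. ?H (snd v))) (at (x, y))"
    by (rule has_derivative_compose[OF has_derivative_snd[OF has_derivative_ident]]) (simp add: H)
  ultimately have D: "((\<lambda>(x, y). G x * H y) has_derivative (\<lambda>v. G x * ?H (snd v) + ?G (fst v) * H y)) (at (x, y))"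
    using has_derivative_mult[of "\<lambda>z. G (fst z)" _ "(x, y)" UNIV "\<lambda>z. H (snd z)"]
    by (simp add: case_prod_unfold)
  then show "(\<lambda>(x, y). G x * H y) differentiable (at (x, y))"
    by (rule differentiableI)
  have "?G 0 = 0" "?H 0 = 0"
    using G H by (auto dest!: has_derivative_linear linear_0)
  then show "partial_deriv (1, 0) (\<lambda>(x, y). G x * H y) (x, y) = partial_deriv 1 G x * H y"
    and "partial_deriv (0, 1) (\<lambda>(x, y). G x * H y) (x, y) = G x * partial_deriv 1 H y"
    using frechet_derivative_at[OF D, symmetric] by (simp_all add: partial_deriv_def)
qed

text \<open>
  The derivatives of a tensor product are again tensor products, so the decay of the product can
  be read off from that of the factors.
\<close>
lemma foldr_partial_deriv_tensor:
  assumes g: "schwartz g" and h: "schwartz h" and bs: "set bs \<subseteq> (Basis :: (real \<times> real) set)"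
  shows "\<exists>as cs. set as \<subseteq> Basis \<and> set cs \<subseteq> Basis \<and>
    foldr partial_deriv bs (\<lambda>(x, y). g x * h y)
      = (\<lambda>(x, y). foldr partial_deriv as g x * foldr partial_deriv cs h y)"
  using bs
proof (induction bs)
  case Nil
  show ?case by (intro exI[of _ "[]"]) simp
next
  case (Cons b bs)
  then obtain as cs where ac: "set as \<subseteq> (Basis :: real set)" "set cs \<subseteq> (Basis :: real set)"
    and eq: "foldr partial_deriv bs (\<lambda>(x, y). g x * h y)
      = (\<lambda>(x, y). foldr partial_deriv as g x * foldr partial_deriv cs h y)" by auto
  have diff: "foldr partial_deriv as g differentiable (at x)"
      "foldr partial_deriv cs h differentiable (at x)" for x
    using g h ac unfolding schwartz_def by blast+
  have "b = (1, 0) \<or> b = (0, 1)"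
    using Cons.prems by (auto simp: Basis_prod_def)
  then show ?case
  proof
    assume b: "b = (1, 0)"
    have "foldr partial_deriv (b # bs) (\<lambda>(x, y). g x * h y)
      = (\<lambda>(x, y). foldr partial_deriv (1 # as) g x * foldr partial_deriv cs h y)"
      using partial_deriv_tensor(1)[OF diff] by (auto simp: b eq fun_eq_iff)
    with ac show ?thesis by (intro exI[of _ "1 # as"] exI[of _ cs]) auto
  next
    assume b: "b = (0, 1)"
    have "foldr partial_deriv (b # bs) (\<lambda>(x, y). g x * h y)
      = (\<lambda>(x, y). foldr partial_deriv as g x * foldr partial_deriv (1 # cs) h y)"
      using partial_deriv_tensor(2)[OF diff] by (auto simp: b eq fun_eq_iff)
    with ac show ?thesis by (intro exI[of _ as] exI[of _ "1 # cs"]) auto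
  qed
qed

lemma schwartz_bounded_power:
  assumes "schwartz f" "set bs \<subseteq> Basis"
  shows "\<exists>B. \<forall>x. norm x ^ k * norm (foldr partial_deriv bs f x) \<le> B"
  using assms unfolding schwartz_def bounded_iff by (fastforce simp: power_abs)

lemma schwartz_tensor:
  fixes g h :: "real \<Rightarrow> complex"
  assumes g: "schwartz g" and h: "schwartz h"
  shows "schwartz (\<lambda>(x, y). g x * h y)"
  unfolding schwartz_def
proof (intro allI impI conjI)
  fix bs :: "(real \<times> real) list" and z :: "real \<times> real" and k :: nat
  assume "set bs \<subseteq> Basis"
  from foldr_partial_deriv_tensor[OF g h this] obtain as cs
    where ac: "set as \<subseteq> (Basis :: real set)" "set cs \<subseteq> (Basis :: real set)"
    and eq: "foldr partial_deriv bs (\<lambda>(x, y). g x * h y)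
      = (\<lambda>(x, y). foldr partial_deriv as g x * foldr partial_deriv cs h y)" by blast
  let ?G = "foldr partial_deriv as g" and ?H = "foldr partial_deriv cs h"
  have diff: "?G differentiable (at x)" "?H differentiable (at x)" for x
    using g h ac unfolding schwartz_def by blast+
  show "foldr partial_deriv bs (\<lambda>(x, y). g x * h y) differentiable (at z)"
    using partial_deriv_tensor(3)[OF diff] by (cases z) (simp add: eq)
  obtain G0 Gk where G: "\<And>x. norm x ^ 0 * norm (?G x) \<le> G0" "\<And>x. norm x ^ k * norm (?G x) \<le> Gk"
    using schwartz_bounded_power[OF g ac(1)] by metis
  obtain H0 Hk where H: "\<And>x. norm x ^ 0 * norm (?H x) \<le> H0" "\<And>x. norm x ^ k * norm (?H x) \<le> Hk"
    using schwartz_bounded_power[OF h ac(2)] by metis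
  have nonneg: "0 \<le> G0" "0 \<le> Gk" "0 \<le> H0" "0 \<le> Hk"
    using G[of 0] H[of 0] by (meson norm_ge_zero mult_nonneg_nonneg zero_le_power order_trans)+
  show "bounded (range (\<lambda>z. norm z ^ k *\<^sub>R foldr partial_deriv bs (\<lambda>(x, y). g x * h y) z))"
  proof (rule boundedI, safe)
    fix x y :: real
    have "norm (x, y) \<le> \<bar>x\<bar> + \<bar>y\<bar>" using norm_Pair_le[of x y] by simp
    also have "\<dots> \<le> 2 * max \<bar>x\<bar> \<bar>y\<bar>" by simp
    finally have "norm (x, y) ^ k \<le> (2 * max \<bar>x\<bar> \<bar>y\<bar>) ^ k"
      by (rule power_mono) simp
    also have "\<dots> \<le> 2 ^ k * (\<bar>x\<bar> ^ k + \<bar>y\<bar> ^ k)"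
      by (simp add: power_mult_distrib max_def)
    finally have "norm (x, y) ^ k * (norm (?G x) * norm (?H y))
        \<le> 2 ^ k * (\<bar>x\<bar> ^ k + \<bar>y\<bar> ^ k) * (norm (?G x) * norm (?H y))"
      by (rule mult_right_mono) simp
    also have "\<dots> = 2 ^ k * ((\<bar>x\<bar> ^ k * norm (?G x)) * norm (?H y) + norm (?G x) * (\<bar>y\<bar> ^ k * norm (?H y)))"
      by (simp add: algebra_simps)
    also have "\<dots> \<le> 2 ^ k * (Gk * H0 + G0 * Hk)"
      using G[of x] H[of y] nonneg by (intro mult_left_mono add_mono mult_mono) auto
    finally show "norm (norm (x, y) ^ k *\<^sub>R foldr partial_deriv bs (\<lambda>(x, y). g x * h y) (x, y)) \<le> 2 ^ k * (Gk * H0 + G0 * Hk)"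
      by (simp add: eq norm_mult)
  qed
qed

section \<open>Schwartz functions of one variable and the folded kernel\<close>

lemma schwartz_continuous_on:
  assumes "schwartz f"
  shows "continuous_on UNIV f"
proof -
  have "f differentiable (at x)" for x
    using assms unfolding schwartz_def by (force dest: spec[of _ "[]"])
  then show ?thesis
    by (auto intro!: continuous_at_imp_continuous_on differentiable_imp_continuous_within)
qed

lemma schwartz_borel_measurable:
  assumes "schwartz f"
  shows "f \<in> borel_measurable borel"
  using schwartz_continuous_on[OF assms] by (rule borel_measurable_continuous_onI)

lemma schwartz_lipschitz:
  fixes g :: "real \<Rightarrow> complex"
  assumes g: "schwartz g"
  obtains L where "0 \<le> L" "\<And>s t. norm (g s - g t) \<le> L * \<bar>s - t\<bar>"
proof -
  obtain L where "norm x ^ 0 * norm (foldr partial_deriv [1] g x) \<le> L" for x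
    using schwartz_bounded_power[OF g, of "[1]" 0] by auto
  then have L: "norm (partial_deriv 1 g x) \<le> L" for x by simp
  have "0 \<le> L" using L[of 0] norm_ge_zero order_trans by blast
  have diff: "g differentiable (at x)" for x
    using g unfolding schwartz_def by (force dest: spec[of _ "[]"])
  then have D: "(g has_derivative (\<lambda>h. h *\<^sub>R partial_deriv 1 g x)) (at x)" for x
    using partial_deriv_has_vector_derivative[of g "vector_derivative g (at x)" x]
    by (simp add: vector_derivative_works has_vector_derivative_def)
  have "norm (g s - g t) \<le> L * norm (s - t)" for s t
  proof (rule differentiable_bound[OF convex_UNIV D])
    show "onorm (\<lambda>h. h *\<^sub>R partial_deriv 1 g x) \<le> L" for x
    proof (rule onorm_bound[OF \<open>0 \<le> L\<close>])
      show "norm (h *\<^sub>R partial_deriv 1 g x) \<le> L * norm h" for h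
        using mult_right_mono[OF L[of x], of "\<bar>h\<bar>"] by (simp add: mult.commute)
    qed
  qed auto
  moreover note \<open>0 \<le> L\<close>
  ultimately show ?thesis using that by simp
qed

lemma schwartz_bounded:
  assumes "schwartz g"
  obtains B where "0 \<le> B" "\<And>t. norm (g t) \<le> B"
proof -
  obtain B where B: "norm x ^ 0 * norm (foldr partial_deriv [] g x) \<le> B" for x
    using schwartz_bounded_power[OF assms, of "[]" 0] by auto
  then have "norm (g x) \<le> B" for x by simp
  moreover from this have "0 \<le> B" by (meson norm_ge_zero order_trans)
  ultimately show ?thesis using that by blast
qed

lemma integrable_inverse_one_plus_square: "integrable lborel (\<lambda>x::real. inverse (1 + x\<^sup>2))"
  using integrable_inverse_1_plus_square by (simp add: set_integrable_def)

text \<open>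
  The case \<open>k = 0\<close> and the case \<open>k = 2\<close> of the decay condition add up to
  \<open>(1 + x\<^sup>2) \<bar>g x\<bar> \<le> B0 + B2\<close>.
\<close>
lemma schwartz_integrable:
  fixes g :: "real \<Rightarrow> complex"
  assumes g: "schwartz g"
  shows "integrable lborel g"
proof -
  obtain B0 where B0: "0 \<le> B0" "\<And>t. norm (g t) \<le> B0" using schwartz_bounded[OF g] by metis
  obtain B2 where "norm x ^ 2 * norm (foldr partial_deriv [] g x) \<le> B2" for x
    using schwartz_bounded_power[OF g, of "[]" 2] by auto
  then have B2: "x\<^sup>2 * norm (g x) \<le> B2" for x by simp
  have "norm (g x) \<le> (B0 + B2) * inverse (1 + x\<^sup>2)" for x
  proof -
    have "norm (g x) * (1 + x\<^sup>2) \<le> B0 + B2" using B0(2)[of x] B2[of x] by (simp add: algebra_simps)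
    moreover have "0 < 1 + x\<^sup>2" by (simp add: add_pos_nonneg)
    ultimately show ?thesis by (simp add: field_simps)
  qed
  then have "norm (g x) \<le> norm ((B0 + B2) * inverse (1 + x\<^sup>2))" for x
    by (rule order_trans) simp
  then have "AE x in lborel. norm (g x) \<le> norm ((B0 + B2) * inverse (1 + x\<^sup>2))"
    by (rule AE_I2)
  moreover have "g \<in> borel_measurable lborel"
    using schwartz_borel_measurable[OF g] by simp
  ultimately show ?thesis
    using Bochner_Integration.integrable_bound integrable_mult_right integrable_inverse_one_plus_square
    by metis
qed

definition chirp :: "real \<Rightarrow> real \<Rightarrow> real \<Rightarrow> complex" where
  "chirp a b t = exp (\<i> * of_real (a * t + b * t\<^sup>2))"

definition truncated :: "real set \<Rightarrow> (real \<Rightarrow> complex) \<Rightarrow> real \<Rightarrow> real \<Rightarrow> real \<Rightarrow> complex" where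
  "truncated E g a b x = (LBINT t:E. g (x - t) * chirp a b t / of_real t)"

text \<open>
  The integrand at \<open>t\<close> plus the integrand at \<open>- t\<close>. The phase \<open>b t\<^sup>2\<close> is even, so only the linear
  frequency changes sign.
\<close>
definition folded :: "(real \<Rightarrow> complex) \<Rightarrow> real \<Rightarrow> real \<Rightarrow> real \<Rightarrow> real \<Rightarrow> complex" where
  "folded g a b x t = (g (x - t) * chirp a b t - g (x + t) * chirp (- a) b t) / of_real t"

lemma chirp_eq_cis: "chirp a b t = cis (a * t + b * t\<^sup>2)"
  by (simp only: chirp_def cis_conv_exp)

lemma norm_chirp [simp]: "norm (chirp a b t) = 1"
  unfolding chirp_def by (rule norm_exp_i_times)

lemma chirp_measurable [measurable]:
  assumes [measurable]: "a \<in> borel_measurable M" "b \<in> borel_measurable M" "t \<in> borel_measurable M"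
  shows "(\<lambda>x. chirp (a x) (b x) (t x)) \<in> borel_measurable M"
  unfolding chirp_def by measurable

text \<open>
  The common factor \<open>exp (\<i> b t\<^sup>2)\<close> has modulus one, and what remains is \<open>2 \<i> sin (a t)\<close>.
\<close>
lemma norm_chirp_reflect_diff_le: "norm (chirp a b t - chirp (- a) b t) \<le> 2 * \<bar>a * t\<bar>"
proof -
  have "chirp a b t - chirp (- a) b t = cis (b * t\<^sup>2) * (cis (a * t) - cis (- (a * t)))"
    by (simp add: chirp_eq_cis cis_mult algebra_simps)
  also have "cis (a * t) - cis (- (a * t)) = Complex 0 (2 * sin (a * t))"
    by (simp add: complex_eq_iff)
  also have "norm (cis (b * t\<^sup>2) * Complex 0 (2 * sin (a * t))) = 2 * \<bar>sin (a * t)\<bar>"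
    by (simp add: norm_mult complex_norm real_sqrt_mult)
  finally show ?thesis
    using abs_sin_x_le_abs_x[of "a * t"] by simp
qed

text \<open>
  The integrable majorant for limits under the folded integral. For \<open>t \<le> 1\<close> the singularity \<open>1 / t\<close> is
  cancelled by the Lipschitz bound on \<open>g\<close> and by the estimate for the reflected phases; for \<open>t > 1\<close>
  there is no singularity, and the decay of \<open>g\<close> suffices. The bound depends on the frequencies only
  through \<open>A\<close>.
\<close>
lemma norm_folded_le:
  assumes lip: "\<And>s t. norm (g s - g t) \<le> L * \<bar>s - t\<bar>" and bd: "\<And>t. norm (g t) \<le> B" and "\<bar>a\<bar> \<le> A" "0 < t"
  shows "norm (folded g a b x t)
    \<le> (2 * L + 2 * A * B) * indicator {0<..1} t + (norm (g (x - t)) + norm (g (x + t)))"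
proof (cases "t \<le> 1")
  case True
  have B: "0 \<le> B" using bd[of 0] norm_ge_zero order_trans by blast
  have "g (x - t) * chirp a b t - g (x + t) * chirp (- a) b t
     = (g (x - t) - g (x + t)) * chirp a b t + g (x + t) * (chirp a b t - chirp (- a) b t)"
    by (simp add: algebra_simps)
  also have "norm \<dots> \<le> norm (g (x - t) - g (x + t)) + norm (g (x + t)) * norm (chirp a b t - chirp (- a) b t)"
    by (rule order_trans[OF norm_triangle_ineq]) (simp add: norm_mult)
  also have "\<dots> \<le> L * \<bar>(x - t) - (x + t)\<bar> + B * (2 * \<bar>a * t\<bar>)"
    by (intro add_mono mult_mono lip bd norm_chirp_reflect_diff_le B) auto
  also have "\<dots> = (2 * L + 2 * (\<bar>a\<bar> * B)) * t"
    using \<open>0 < t\<close> by (simp add: abs_mult algebra_simps)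
  also have "\<dots> \<le> (2 * L + 2 * (A * B)) * t"
    using assms(3,4) B by (intro mult_right_mono add_left_mono mult_left_mono) auto
  finally have "norm (folded g a b x t) \<le> 2 * L + 2 * A * B"
    using \<open>0 < t\<close> by (simp add: folded_def norm_divide divide_le_eq mult.assoc)
  then show ?thesis using True \<open>0 < t\<close> by (simp add: add_increasing2)
next
  case False
  have "norm (g (x - t) * chirp a b t - g (x + t) * chirp (- a) b t) \<le> norm (g (x - t)) + norm (g (x + t))"
    by (rule order_trans[OF norm_triangle_ineq4]) (simp add: norm_mult)
  also have "\<dots> \<le> (norm (g (x - t)) + norm (g (x + t))) * t"
    using False mult_left_mono[of 1 t "norm (g (x - t)) + norm (g (x + t))"] by simp
  finally show ?thesis
    using False by (simp add: folded_def norm_divide divide_le_eq)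
qed

section \<open>The principal value as a limit of truncations\<close>

context
  fixes g :: "real \<Rightarrow> complex"
  assumes g: "schwartz g"
begin

lemma integrable_shift: "integrable lborel (\<lambda>t. g (x - t))" "integrable lborel (\<lambda>t. g (x + t))"
  using lborel_integrable_real_affine[OF schwartz_integrable[OF g], of "-1" x]
    lborel_integrable_real_affine[OF schwartz_integrable[OF g], of 1 x] by simp_all

lemma integrable_truncated:
  assumes [measurable]: "E \<in> sets borel" and E: "E \<subseteq> {t. \<epsilon> \<le> \<bar>t\<bar>}" and "0 < \<epsilon>"
  shows "set_integrable lborel E (\<lambda>t. g (x - t) * chirp a b t / of_real t)"
  unfolding set_integrable_def
proof (rule Bochner_Integration.integrable_bound)
  note [measurable] = schwartz_borel_measurable[OF g]
  show "integrable lborel (\<lambda>t. g (x - t) /\<^sub>R \<epsilon>)" using integrable_shift(1) by simp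
  have "norm (g (x - t) * chirp a b t / of_real t) \<le> norm (g (x - t)) / \<epsilon>" if "t \<in> E" for t
    using that E \<open>0 < \<epsilon>\<close> by (auto simp: norm_divide norm_mult intro!: divide_left_mono)
  then show "AE t in lborel. norm (indicator E t *\<^sub>R (g (x - t) * chirp a b t / of_real t))
      \<le> norm (g (x - t) /\<^sub>R \<epsilon>)"
    using \<open>0 < \<epsilon>\<close> by (auto simp: indicator_def divide_inverse mult.commute)
  show "(\<lambda>t. indicator E t *\<^sub>R (g (x - t) * chirp a b t / of_real t)) \<in> borel_measurable lborel"
    by measurable
qed

text \<open>
  Away from the origin the integral converges absolutely, so over a symmetric set the negative half
  line may be reflected onto the positive one. Here the singularity cancels, and the expression
  keeps its meaning when \<open>E\<close> grows to the whole line.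
\<close>
lemma truncated_eq_folded:
  assumes [measurable]: "E \<in> sets borel" and E: "E \<subseteq> {t. \<epsilon> \<le> \<bar>t\<bar>}" and "0 < \<epsilon>"
    and sym: "\<And>t. - t \<in> E \<longleftrightarrow> t \<in> E"
  shows "truncated E g a b x = (LBINT t:{0<..}. indicator E t *\<^sub>R folded g a b x t)"
proof -
  define k where "k t = indicator E t *\<^sub>R (g (x - t) * chirp a b t / of_real t)" for t
  have k: "integrable lborel k"
    using integrable_truncated[OF assms(1-3)] unfolding k_def set_integrable_def .
  have "k 0 = 0" by (simp add: k_def)
  have kp: "integrable lborel (\<lambda>t. indicator {0<..} t *\<^sub>R k t)"
    and km: "integrable lborel (\<lambda>t. indicator {..<0} t *\<^sub>R k t)"
    using k by (auto intro!: integrable_mult_indicator)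
  have km': "integrable lborel (\<lambda>t. indicator {0<..} t *\<^sub>R k (- t))"
    using lborel_integrable_real_affine[OF km, of "-1" 0]
    by (rule Bochner_Integration.integrable_cong[THEN iffD1, rotated -1]) (auto simp: indicator_def)
  have "truncated E g a b x = integral\<^sup>L lborel k"
    unfolding truncated_def set_lebesgue_integral_def k_def ..
  also have "\<dots> = (\<integral>t. indicator {0<..} t *\<^sub>R k t + indicator {..<0} t *\<^sub>R k t \<partial>lborel)"
    using \<open>k 0 = 0\<close> by (intro Bochner_Integration.integral_cong refl) (auto simp: indicator_def less_le)
  also have "\<dots> = (\<integral>t. indicator {0<..} t *\<^sub>R k t \<partial>lborel) + (\<integral>t. indicator {..<0} t *\<^sub>R k t \<partial>lborel)"
    by (rule Bochner_Integration.integral_add[OF kp km])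
  also have "(\<integral>t. indicator {..<0} t *\<^sub>R k t \<partial>lborel) = (\<integral>t. indicator {0<..} t *\<^sub>R k (- t) \<partial>lborel)"
    by (subst lborel_integral_real_affine[where c = "-1" and t = 0])
       (auto intro!: Bochner_Integration.integral_cong simp: indicator_def)
  also have "(\<integral>t. indicator {0<..} t *\<^sub>R k t \<partial>lborel) + \<dots>
      = (\<integral>t. indicator {0<..} t *\<^sub>R k t + indicator {0<..} t *\<^sub>R k (- t) \<partial>lborel)"
    by (rule Bochner_Integration.integral_add[OF kp km', symmetric])
  also have "\<dots> = (LBINT t:{0<..}. indicator E t *\<^sub>R folded g a b x t)"
    unfolding set_lebesgue_integral_def
  proof (intro Bochner_Integration.integral_cong refl)
    fix t :: real
    have "k t + k (- t) = indicator E t *\<^sub>R folded g a b x t"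
      using sym[of t] by (auto simp: k_def folded_def indicator_def chirp_def diff_divide_distrib)
    then show "indicator {0<..} t *\<^sub>R k t + indicator {0<..} t *\<^sub>R k (- t)
      = indicator {0<..} t *\<^sub>R (indicator E t *\<^sub>R folded g a b x t)"
      by (simp flip: scaleR_right_distrib)
  qed
  finally show ?thesis .
qed

lemma folded_measurable: "folded g a b x \<in> borel_measurable borel"
proof -
  note [measurable] = schwartz_borel_measurable[OF g]
  show ?thesis unfolding folded_def by measurable
qed

text \<open>
  One dominated convergence argument for two uses: the cutoffs \<open>c n\<close> are indicators when the
  truncation is removed, and constant when the frequencies vary.
\<close>
lemma folded_integral_tendsto:
  assumes lim: "\<And>t. 0 < t \<Longrightarrow> (\<lambda>n. c n t *\<^sub>R folded g (a n) (b n) x t) \<longlonglongrightarrow> folded g a' b' x t"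
    and [measurable]: "\<And>n. c n \<in> borel_measurable borel" and c: "\<And>n t. \<bar>c n t\<bar> \<le> 1"
    and A: "\<And>n. \<bar>a n\<bar> \<le> A"
  shows "(\<lambda>n. LBINT t:{0<..}. c n t *\<^sub>R folded g (a n) (b n) x t) \<longlonglongrightarrow> (LBINT t:{0<..}. folded g a' b' x t)"
proof -
  note [measurable] = folded_measurable
  obtain L where L: "\<And>s t. norm (g s - g t) \<le> L * \<bar>s - t\<bar>" using schwartz_lipschitz[OF g] by metis
  obtain B where B: "\<And>t. norm (g t) \<le> B" using schwartz_bounded[OF g] by metis
  let ?D = "\<lambda>t. (2 * L + 2 * A * B) * indicator {0<..1} t + (norm (g (x - t)) + norm (g (x + t)))"
  show ?thesis
    unfolding set_lebesgue_integral_def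
  proof (rule integral_dominated_convergence[where w = ?D])
    show "integrable lborel ?D"
      using integrable_shift by (intro Bochner_Integration.integrable_add integrable_norm integrable_mult_right) simp_all
    show "AE t in lborel. (\<lambda>n. indicator {0<..} t *\<^sub>R (c n t *\<^sub>R folded g (a n) (b n) x t))
        \<longlonglongrightarrow> indicator {0<..} t *\<^sub>R folded g a' b' x t"
      using lim by (auto simp: indicator_def)
    show "AE t in lborel. norm (indicator {0<..} t *\<^sub>R (c n t *\<^sub>R folded g (a n) (b n) x t)) \<le> ?D t" for n
    proof (rule AE_I2)
      fix t :: real
      show "norm (indicator {0<..} t *\<^sub>R (c n t *\<^sub>R folded g (a n) (b n) x t)) \<le> ?D t"
      proof (cases "0 < t")
        case True
        have "norm (c n t *\<^sub>R folded g (a n) (b n) x t) \<le> 1 * norm (folded g (a n) (b n) x t)"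
          unfolding norm_scaleR by (intro mult_right_mono c) simp
        also have "\<dots> \<le> ?D t" using norm_folded_le[OF L B A True] by simp
        finally show ?thesis using True by simp
      qed (simp add: indicator_def)
    qed
  qed measurable
qed

lemma truncated_tendsto:
  assumes [measurable]: "\<And>n. E n \<in> sets borel"
    and "\<And>n. E n \<subseteq> {t. \<epsilon> n \<le> \<bar>t\<bar>}" "\<And>n. 0 < \<epsilon> n" "\<And>n t. - t \<in> E n \<longleftrightarrow> t \<in> E n"
    and ev: "\<And>t. 0 < t \<Longrightarrow> eventually (\<lambda>n. t \<in> E n) sequentially"
  shows "(\<lambda>n. truncated (E n) g a b x) \<longlonglongrightarrow> (LBINT t:{0<..}. folded g a b x t)"
proof -
  have "(\<lambda>n. LBINT t:{0<..}. indicator (E n) t *\<^sub>R folded g a b x t) \<longlonglongrightarrow> (LBINT t:{0<..}. folded g a b x t)"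
  proof (rule folded_integral_tendsto)
    show "(\<lambda>n. indicator (E n) t *\<^sub>R folded g a b x t) \<longlonglongrightarrow> folded g a b x t" if "0 < t" for t
      by (rule tendsto_eventually) (use ev[OF that] in eventually_elim, simp)
  qed (auto simp: indicator_def)
  then show ?thesis
    using truncated_eq_folded[OF assms(1-4)] by simp
qed

lemma pv_integral_eq_folded:
  "pv_integral (\<lambda>t. g (x - t) * exp (\<i> * of_real (a * t + b * t\<^sup>2)) / of_real t)
    = (LBINT t:{0<..}. folded g a b x t)"
  unfolding pv_integral_def chirp_def[symmetric] truncated_def[symmetric]
proof (rule tendsto_Lim)
  show "((\<lambda>\<epsilon>. truncated {t. \<epsilon> \<le> \<bar>t\<bar>} g a b x) \<longlongrightarrow> (LBINT t:{0<..}. folded g a b x t)) (at_right 0)"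
  proof (rule tendsto_at_right_sequentially[of 0 1])
    fix S :: "nat \<Rightarrow> real" assume S: "\<And>n. 0 < S n" "S \<longlonglongrightarrow> 0"
    have "eventually (\<lambda>n. S n \<le> \<bar>t\<bar>) sequentially" if "0 < t" for t
      using order_tendstoD(2)[OF S(2) that] by eventually_elim simp
    then show "(\<lambda>n. truncated {t. S n \<le> \<bar>t\<bar>} g a b x) \<longlonglongrightarrow> (LBINT t:{0<..}. folded g a b x t)"
      using S(1) by (intro truncated_tendsto[where \<epsilon> = S]) auto
  qed simp
qed simp

lemma folded_integral_continuous:
  assumes "a \<longlonglongrightarrow> a'" "b \<longlonglongrightarrow> b'"
  shows "(\<lambda>n. LBINT t:{0<..}. folded g (a n) (b n) x t) \<longlonglongrightarrow> (LBINT t:{0<..}. folded g a' b' x t)"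
proof -
  from assms(1) obtain A where A: "\<And>n. \<bar>a n\<bar> \<le> A"
    by (metis convergentI convergent_imp_Bseq BseqE real_norm_def)
  have "(\<lambda>n. LBINT t:{0<..}. 1 *\<^sub>R folded g (a n) (b n) x t) \<longlonglongrightarrow> (LBINT t:{0<..}. folded g a' b' x t)"
  proof (rule folded_integral_tendsto[OF _ _ _ A])
    show "(\<lambda>n. 1 *\<^sub>R folded g (a n) (b n) x t) \<longlonglongrightarrow> folded g a' b' x t" if "0 < t" for t
      unfolding folded_def chirp_def using that assms by (auto intro!: tendsto_intros)
  qed auto
  then show ?thesis by simp
qed

lemma truncated_measurable:
  assumes [measurable]: "a \<in> borel_measurable M" "b \<in> borel_measurable M" "u \<in> borel_measurable M" "E \<in> sets borel"
  shows "(\<lambda>x. truncated E g (a x) (b x) (u x)) \<in> borel_measurable M"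
proof -
  note [measurable] = schwartz_borel_measurable[OF g]
  show ?thesis unfolding truncated_def set_lebesgue_integral_def by measurable
qed

end

section \<open>Transfer from the plane to the line\<close>

lemma L2norm_power2: "(L2norm h)\<^sup>2 = (\<integral>\<^sup>+ x. (h x)\<^sup>2 \<partial>lborel)"
proof (cases "(\<integral>\<^sup>+ x. (h x)\<^sup>2 \<partial>lborel) = \<infinity>")
  case True
  then show ?thesis by (simp add: L2norm_def top_power_ennreal)
next
  case False
  then obtain r where "0 \<le> r" "(\<integral>\<^sup>+ x. (h x)\<^sup>2 \<partial>lborel) = ennreal r"
    by (cases "\<integral>\<^sup>+ x. (h x)\<^sup>2 \<partial>lborel") auto
  then show ?thesis by (simp add: L2norm_def ennreal_power)
qed

text \<open>
  With this, an \<open>L\<^sup>2\<close> bound is an inequality between integrals of squares, to which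
  the theorems on nonnegative integrals apply.
\<close>
lemma ennreal_power2_le_iff: "a\<^sup>2 \<le> b\<^sup>2 \<longleftrightarrow> a \<le> (b :: ennreal)"
proof
  assume "a\<^sup>2 \<le> b\<^sup>2"
  then show "a \<le> b"
    by (cases a; cases b) (auto simp: ennreal_power top_power_ennreal power2_le_iff_abs_le top_unique)
qed (rule power_mono, simp_all)

lemma L2norm_le_iff:
  "L2norm h \<le> C * L2norm f \<longleftrightarrow>
    (\<integral>\<^sup>+ x. (h x)\<^sup>2 \<partial>lborel) \<le> C\<^sup>2 * (\<integral>\<^sup>+ x. (f x)\<^sup>2 \<partial>lborel)"
  by (simp add: power_mult_distrib flip: ennreal_power2_le_iff[of "L2norm h"] L2norm_power2)

lemma fst_snd_borel_measurable [measurable]: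
  "fst \<in> borel_measurable borel" "snd \<in> borel_measurable borel"
  by (auto intro!: borel_measurable_continuous_onI continuous_intros)

lemma nn_integral_lborel_Pair:
  fixes f :: "real \<times> real \<Rightarrow> ennreal"
  assumes "f \<in> borel_measurable borel"
  shows "(\<integral>\<^sup>+ z. f z \<partial>lborel) = (\<integral>\<^sup>+ x. \<integral>\<^sup>+ y. f (x, y) \<partial>lborel \<partial>lborel)"
  using lborel.nn_integral_fst[of f lborel] assms by (simp add: lborel_prod)

lemma nn_integral_lborel_tensor:
  fixes u v :: "real \<Rightarrow> ennreal"
  assumes [measurable]: "u \<in> borel_measurable borel" "v \<in> borel_measurable borel"
  shows "(\<integral>\<^sup>+ z. u (fst z) * v (snd z) \<partial>lborel) = (\<integral>\<^sup>+ x. u x \<partial>lborel) * (\<integral>\<^sup>+ y. v y \<partial>lborel)"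
  by (subst nn_integral_lborel_Pair) (simp_all add: nn_integral_cmult nn_integral_multc)

lemma nn_integral_lborel_scale_snd:
  fixes f :: "real \<times> real \<Rightarrow> ennreal"
  assumes [measurable]: "f \<in> borel_measurable borel" and "0 < s"
  shows "(\<integral>\<^sup>+ z. f z \<partial>lborel) = ennreal s * (\<integral>\<^sup>+ z. f (fst z, s * snd z) \<partial>lborel)"
proof -
  have "(\<integral>\<^sup>+ z. f z \<partial>lborel) = (\<integral>\<^sup>+ x. \<integral>\<^sup>+ y. f (x, y) \<partial>lborel \<partial>lborel)"
    by (rule nn_integral_lborel_Pair) simp
  also have "\<dots> = (\<integral>\<^sup>+ x. ennreal s * (\<integral>\<^sup>+ y. f (x, s * y) \<partial>lborel) \<partial>lborel)"
    using \<open>0 < s\<close> by (subst nn_integral_real_affine[where c = s and t = 0]) simp_all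
  also have "\<dots> = ennreal s * (\<integral>\<^sup>+ x. \<integral>\<^sup>+ y. f (x, s * y) \<partial>lborel \<partial>lborel)"
    by (rule nn_integral_cmult) measurable
  also have "(\<integral>\<^sup>+ x. \<integral>\<^sup>+ y. f (x, s * y) \<partial>lborel \<partial>lborel) = (\<integral>\<^sup>+ z. f (fst z, s * snd z) \<partial>lborel)"
    by (subst nn_integral_lborel_Pair) simp_all
  finally show ?thesis .
qed

text \<open>
  The \<open>L\<^sup>2\<close> mass of the Gaussian appears on both sides of the transferred estimate; it can be
  cancelled because it is neither zero nor infinite.
\<close>
lemma nn_integral_gaussian_square:
  defines "\<Phi> \<equiv> \<integral>\<^sup>+ y. (ennreal (exp (- y\<^sup>2)))\<^sup>2 \<partial>lborel"
  shows "\<Phi> \<noteq> 0" "\<Phi> \<noteq> top"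
proof -
  have eq: "(ennreal (exp (- y\<^sup>2)))\<^sup>2 = ennreal (norm (complex_of_real (exp (- 2 * y\<^sup>2))))" for y :: real
    by (simp add: ennreal_power flip: exp_double)
  show "\<Phi> \<noteq> top"
    using schwartz_integrable[OF schwartz_gaussian[of 2]]
    by (simp add: \<Phi>_def eq integrable_iff_bounded less_top)
  show "\<Phi> \<noteq> 0"
    using AE_iff_null_sets[of "UNIV :: real set" lborel]
    by (simp add: \<Phi>_def nn_integral_0_iff_AE null_sets_def)
qed

text \<open>
  Test the planar estimate on \<open>g x * h s y\<close> with the wide Gaussian \<open>h s\<close>. The substitution
  \<open>y = s y'\<close> produces the same factor \<open>s\<close> on both sides, and what remains on the left converges, as
  \<open>s \<rightarrow> \<infinity>\<close>, to the one-dimensional operator times the fixed Gaussian \<open>exp (- y'\<^sup>2)\<close>.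
\<close>
lemma truncated_L2_bound:
  fixes g :: "real \<Rightarrow> complex" and a b :: "real \<Rightarrow> real"
  assumes bound: "\<And>f :: real \<times> real \<Rightarrow> complex. schwartz f \<Longrightarrow>
       cL2norm (\<lambda>(x, y). LBINT t:E. f (x - t, y - t\<^sup>2) * chirp (a x) (b x) t / of_real t) \<le> C * cL2norm f"
    and g: "schwartz g"
    and [measurable]: "a \<in> borel_measurable borel" "b \<in> borel_measurable borel" "E \<in> sets borel"
    and E: "E \<subseteq> {t. \<epsilon> \<le> \<bar>t\<bar>}" "0 < \<epsilon>"
  shows "cL2norm (\<lambda>x. truncated E g (a x) (b x) x) \<le> C * cL2norm g"
proof -
  define G where "G = (\<integral>\<^sup>+ x. (ennreal (norm (g x)))\<^sup>2 \<partial>lborel)"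
  define \<Phi> where "\<Phi> = (\<integral>\<^sup>+ y. (ennreal (exp (- y\<^sup>2)))\<^sup>2 \<partial>lborel)"
  define h :: "real \<Rightarrow> real \<Rightarrow> complex" where "h s y = of_real (exp (- (1 / s\<^sup>2) * y\<^sup>2))" for s y
  define F where "F s = (\<lambda>(x, y). LBINT t:E. g (x - t) * h s (y - t\<^sup>2) * chirp (a x) (b x) t / of_real t)" for s
  note [measurable] = schwartz_borel_measurable[OF g]
  have h_meas [measurable]: "(\<lambda>x. h s (u x)) \<in> borel_measurable M" if [measurable]: "u \<in> borel_measurable M" for s u M
    unfolding h_def by measurable
  have F_meas [measurable]: "F s \<in> borel_measurable borel" for s
    unfolding F_def set_lebesgue_integral_def case_prod_unfold by measurable
  have scale: "h s (s * y) = of_real (exp (- y\<^sup>2))" if "0 < s" for s y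
    using that by (simp add: h_def power_mult_distrib)
  have F_bound: "(\<integral>\<^sup>+ z. (ennreal (norm (F s (fst z, s * snd z))))\<^sup>2 \<partial>lborel) \<le> C\<^sup>2 * (G * \<Phi>)" if "0 < s" for s
  proof -
    let ?f = "\<lambda>(x, y). g x * h s y"
    have "schwartz ?f"
      using schwartz_tensor[OF g schwartz_gaussian, of "1 / s\<^sup>2"] that by (simp add: h_def)
    from bound[OF this] have "(\<integral>\<^sup>+ z. (ennreal (norm (F s z)))\<^sup>2 \<partial>lborel) \<le> C\<^sup>2 * (\<integral>\<^sup>+ z. (ennreal (norm (?f z)))\<^sup>2 \<partial>lborel)"
      by (simp add: L2norm_le_iff F_def)
    also have "(\<integral>\<^sup>+ z. (ennreal (norm (?f z)))\<^sup>2 \<partial>lborel)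
        = ennreal s * (\<integral>\<^sup>+ z. (ennreal (norm (?f (fst z, s * snd z))))\<^sup>2 \<partial>lborel)"
      by (rule nn_integral_lborel_scale_snd[OF _ that]) (simp add: case_prod_unfold)
    also have "(\<integral>\<^sup>+ z. (ennreal (norm (?f (fst z, s * snd z))))\<^sup>2 \<partial>lborel) = G * \<Phi>"
      unfolding G_def \<Phi>_def
      by (subst nn_integral_lborel_tensor[symmetric])
         (simp_all add: scale[OF that] norm_mult ennreal_mult power_mult_distrib)
    also have "(\<integral>\<^sup>+ z. (ennreal (norm (F s z)))\<^sup>2 \<partial>lborel)
        = ennreal s * (\<integral>\<^sup>+ z. (ennreal (norm (F s (fst z, s * snd z))))\<^sup>2 \<partial>lborel)"
      by (rule nn_integral_lborel_scale_snd[OF _ that]) simp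
    finally have "ennreal s * (\<integral>\<^sup>+ z. (ennreal (norm (F s (fst z, s * snd z))))\<^sup>2 \<partial>lborel)
        \<le> ennreal s * (C\<^sup>2 * (G * \<Phi>))"
      by (simp add: mult_ac)
    then show ?thesis using that by (subst (asm) ennreal_mult_le_mult_iff) auto
  qed
  have lim: "(\<lambda>n. F (real (Suc n)) (x, real (Suc n) * y)) \<longlonglongrightarrow> truncated E g (a x) (b x) x * of_real (exp (- y\<^sup>2))" for x y
  proof -
    define k where "k t = indicator E t *\<^sub>R (g (x - t) * chirp (a x) (b x) t / of_real t)" for t
    have k: "integrable lborel k"
      using integrable_truncated[OF g _ E] unfolding k_def set_integrable_def by simp
    then have [measurable]: "k \<in> borel_measurable borel" by simp
    \<comment> \<open>After scaling, the parabolic shift \<open>t\<^sup>2\<close> is divided by \<open>s\<close> and disappears.\<close>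
    have h_lim: "(\<lambda>n. h (real (Suc n)) (real (Suc n) * y - t\<^sup>2)) \<longlonglongrightarrow> of_real (exp (- y\<^sup>2))" for t
    proof -
      have "h (real (Suc n)) (real (Suc n) * y - t\<^sup>2) = of_real (exp (- (y - t\<^sup>2 * inverse (real (Suc n)))\<^sup>2))" for n
      proof -
        have "real (Suc n) * y - t\<^sup>2 = real (Suc n) * (y - t\<^sup>2 * inverse (real (Suc n)))"
          by (simp add: right_diff_distrib del: of_nat_Suc)
        then show ?thesis using scale[of "real (Suc n)"] by simp
      qed
      moreover have "(\<lambda>n. complex_of_real (exp (- (y - t\<^sup>2 * inverse (real (Suc n)))\<^sup>2)))
          \<longlonglongrightarrow> of_real (exp (- (y - t\<^sup>2 * 0)\<^sup>2))"
        by (intro tendsto_intros LIMSEQ_inverse_real_of_nat)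
      ultimately show ?thesis by simp
    qed
    have "(\<lambda>n. \<integral>t. k t * h (real (Suc n)) (real (Suc n) * y - t\<^sup>2) \<partial>lborel)
        \<longlonglongrightarrow> (\<integral>t. k t * of_real (exp (- y\<^sup>2)) \<partial>lborel)"
    proof (rule integral_dominated_convergence[where w = "\<lambda>t. norm (k t)"])
      show "AE t in lborel. (\<lambda>n. k t * h (real (Suc n)) (real (Suc n) * y - t\<^sup>2)) \<longlonglongrightarrow> k t * of_real (exp (- y\<^sup>2))"
        by (intro AE_I2 tendsto_intros h_lim)
      show "AE t in lborel. norm (k t * h (real (Suc n)) (real (Suc n) * y - t\<^sup>2)) \<le> norm (k t)" for n
        by (intro AE_I2) (auto simp: h_def norm_mult intro!: mult_left_le)
    qed (use k in simp_all)
    also have "(\<lambda>n. \<integral>t. k t * h (real (Suc n)) (real (Suc n) * y - t\<^sup>2) \<partial>lborel)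
        = (\<lambda>n. F (real (Suc n)) (x, real (Suc n) * y))"
      unfolding F_def k_def set_lebesgue_integral_def by (simp add: mult_ac)
    also have "(\<integral>t. k t * of_real (exp (- y\<^sup>2)) \<partial>lborel) = truncated E g (a x) (b x) x * of_real (exp (- y\<^sup>2))"
      unfolding truncated_def set_lebesgue_integral_def k_def[symmetric] by simp
    finally show ?thesis .
  qed
  have [measurable]: "(\<lambda>x. truncated E g (a x) (b x) x) \<in> borel_measurable borel"
    by (rule truncated_measurable[OF g]) simp_all
  have "(\<integral>\<^sup>+ x. (ennreal (norm (truncated E g (a x) (b x) x)))\<^sup>2 \<partial>lborel) * \<Phi>
      = (\<integral>\<^sup>+ z. (ennreal (norm (truncated E g (a (fst z)) (b (fst z)) (fst z))))\<^sup>2 * (ennreal (exp (- (snd z)\<^sup>2)))\<^sup>2 \<partial>lborel)"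
    unfolding \<Phi>_def by (subst nn_integral_lborel_tensor) simp_all
  also have "\<dots> = (\<integral>\<^sup>+ z. liminf (\<lambda>n. (ennreal (norm (F (real (Suc n)) (fst z, real (Suc n) * snd z))))\<^sup>2) \<partial>lborel)"
  proof (intro nn_integral_cong)
    fix z :: "real \<times> real"
    have "(\<lambda>n. ennreal ((norm (F (real (Suc n)) (fst z, real (Suc n) * snd z)))\<^sup>2))
      \<longlonglongrightarrow> ennreal ((norm (truncated E g (a (fst z)) (b (fst z)) (fst z) * of_real (exp (- (snd z)\<^sup>2))))\<^sup>2)"
      by (intro tendsto_intros lim)
    from lim_imp_Liminf[OF _ this]
    show "(ennreal (norm (truncated E g (a (fst z)) (b (fst z)) (fst z))))\<^sup>2 * (ennreal (exp (- (snd z)\<^sup>2)))\<^sup>2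
      = liminf (\<lambda>n. (ennreal (norm (F (real (Suc n)) (fst z, real (Suc n) * snd z))))\<^sup>2)"
      by (simp add: ennreal_power norm_mult power_mult_distrib ennreal_mult)
  qed
  also have "\<dots> \<le> liminf (\<lambda>n. \<integral>\<^sup>+ z. (ennreal (norm (F (real (Suc n)) (fst z, real (Suc n) * snd z))))\<^sup>2 \<partial>lborel)"
    by (rule nn_integral_liminf) simp
  also have "\<dots> \<le> C\<^sup>2 * (G * \<Phi>)"
    by (rule Liminf_le) (use F_bound in simp_all)
  finally have "(\<integral>\<^sup>+ x. (ennreal (norm (truncated E g (a x) (b x) x)))\<^sup>2 \<partial>lborel) * \<Phi> \<le> (C\<^sup>2 * G) * \<Phi>"
    by (simp add: mult.assoc)
  then have "(\<integral>\<^sup>+ x. (ennreal (norm (truncated E g (a x) (b x) x)))\<^sup>2 \<partial>lborel) \<le> C\<^sup>2 * G"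
    using nn_integral_gaussian_square unfolding \<Phi>_def[symmetric]
    by (simp add: mult.commute[of _ \<Phi>] ennreal_mult_le_mult_iff)
  then show ?thesis by (simp add: L2norm_le_iff G_def)
qed

section \<open>Linearization of the supremum\<close>

text \<open>
  Among finitely many parameters the best one can be chosen measurably: compare the best choice so
  far with the next candidate, and switch on the measurable set where the candidate wins.
\<close>
lemma measurable_maximizer:
  fixes T :: "'p::topological_space \<Rightarrow> 'a \<Rightarrow> real"
  assumes [measurable]: "\<And>p. p \<in> borel_measurable M \<Longrightarrow> (\<lambda>x. T (p x) x) \<in> borel_measurable M"
  shows "\<exists>p \<in> borel_measurable M. \<forall>x. \<forall>k \<le> (n::nat). T (q k) x \<le> T (p x) x"
proof (induction n)
  case 0
  show ?case by (rule bexI[of _ "\<lambda>_. q 0"]) auto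
next
  case (Suc n)
  then obtain p where p [measurable]: "p \<in> borel_measurable M" and le: "\<And>x k. k \<le> n \<Longrightarrow> T (q k) x \<le> T (p x) x"
    by blast
  let ?p = "\<lambda>x. if T (p x) x < T (q (Suc n)) x then q (Suc n) else p x"
  have [measurable]: "T c \<in> borel_measurable M" for c
    using assms[of "\<lambda>_. c"] by simp
  have meas: "?p \<in> borel_measurable M" by measurable
  have "T (q k) x \<le> T (?p x) x" if "k \<le> Suc n" for x k
    using that le[of k x] by (auto simp: le_Suc_eq intro: order_trans less_imp_le)
  then show ?case by (intro bexI[OF _ meas] allI impI)
qed

lemma liminf_power2_ennreal:
  fixes v :: "nat \<Rightarrow> ennreal"
  shows "liminf (\<lambda>n. (v n)\<^sup>2) = (liminf v)\<^sup>2"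
proof (rule Liminf_compose_continuous_mono)
  have "((\<lambda>x. x * x) \<longlongrightarrow> y * y) (at y)" for y :: ennreal
    by (intro tendsto_mult_ennreal tendsto_ident_at) auto
  then show "continuous_on UNIV (\<lambda>x::ennreal. x\<^sup>2)"
    by (auto simp: continuous_on_def power2_eq_square)
  show "mono (\<lambda>x::ennreal. x\<^sup>2)"
    by (intro monoI power_mono) auto
qed simp

lemma countable_sequentially_dense:
  "\<exists>q :: nat \<Rightarrow> real \<times> real. \<forall>p. \<exists>r. (\<lambda>j. q (r j)) \<longlonglongrightarrow> p"
proof -
  obtain D :: "(real \<times> real) set" where D: "countable D" "\<And>X. open X \<Longrightarrow> X \<noteq> {} \<Longrightarrow> \<exists>d\<in>D. d \<in> X"
    using countable_dense_exists by blast
  have "D \<noteq> {}" using D(2)[of UNIV] by auto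
  show ?thesis
  proof (intro exI[of _ "from_nat_into D"] allI)
    fix p :: "real \<times> real"
    have "p \<in> closure D"
      unfolding closure_approachable
    proof (intro allI impI)
      fix e :: real assume "0 < e"
      then show "\<exists>y\<in>D. dist y p < e"
        using D(2)[of "ball p e"] by (auto simp: dist_commute)
    qed
    then obtain d where d: "\<And>j. d j \<in> D" "d \<longlonglongrightarrow> p"
      unfolding closure_sequential by blast
    obtain r where "\<And>j. from_nat_into D (r j) = d j"
      using from_nat_into_surj[OF D(1) d(1)] by metis
    with d(2) show "\<exists>r. (\<lambda>j. from_nat_into D (r j)) \<longlonglongrightarrow> p"
      by (intro exI[of _ r]) simp
  qed
qed

theorem proposition6p1:
  assumes "\<exists>C::ennreal. C < \<infinity> \<and>
    (\<forall>(f :: real \<times> real \<Rightarrow> complex) (N\<^sub>1 :: real \<Rightarrow> real) (N\<^sub>2 :: real \<Rightarrow> real) (\<epsilon>::real) (R::real).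
       schwartz f \<longrightarrow> N\<^sub>1 \<in> borel_measurable borel \<longrightarrow> N\<^sub>2 \<in> borel_measurable borel \<longrightarrow>
       0 < \<epsilon> \<longrightarrow> \<epsilon> < R \<longrightarrow>
       cL2norm (\<lambda>(x, y). LBINT t:{t. \<epsilon> \<le> \<bar>t\<bar> \<and> \<bar>t\<bar> \<le> R}.
          f (x - t, y - t\<^sup>2) * exp (\<i> * of_real (N\<^sub>1 x * t + N\<^sub>2 x * t\<^sup>2)) / of_real t)
       \<le> C * cL2norm f)"
  shows "bounded_on_L2 carleson_quad"
proof -
  from assms obtain C where C: "C < \<infinity>" and bound: "\<And>(f :: real \<times> real \<Rightarrow> complex) a b \<epsilon> R.
      schwartz f \<Longrightarrow> a \<in> borel_measurable borel \<Longrightarrow> b \<in> borel_measurable borel \<Longrightarrow> 0 < \<epsilon> \<Longrightarrow> \<epsilon> < R \<Longrightarrow>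
       cL2norm (\<lambda>(x, y). LBINT t:{t. \<epsilon> \<le> \<bar>t\<bar> \<and> \<bar>t\<bar> \<le> R}.
          f (x - t, y - t\<^sup>2) * chirp (a x) (b x) t / of_real t) \<le> C * cL2norm f"
    unfolding chirp_def by blast
  obtain q :: "nat \<Rightarrow> real \<times> real" where q: "\<And>p. \<exists>r. (\<lambda>j. q (r j)) \<longlonglongrightarrow> p"
    using countable_sequentially_dense by blast
  \<comment> \<open>Here \<open>n + 2\<close> rather than \<open>n + 1\<close> makes the inner radius smaller than the outer one already for \<open>n = 0\<close>.\<close>
  define E where "E n = {t::real. inverse (real (Suc (Suc n))) \<le> \<bar>t\<bar> \<and> \<bar>t\<bar> \<le> real (Suc n)}" for n
  have [measurable]: "E n \<in> sets borel" for n unfolding E_def by measurable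
  have "carleson_quad g \<in> borel_measurable borel \<and> L2norm (carleson_quad g) \<le> C * cL2norm g"
    if g: "schwartz g" for g
  proof -
    define P where "P p x = (LBINT t:{0<..}. folded g (fst p) (snd p) x t)" for p x
    have carleson: "carleson_quad g x = (SUP p. ennreal (norm (P p x)))" for x
      unfolding carleson_quad_def P_def pv_integral_eq_folded[OF g] by (simp add: case_prod_unfold)
    have P_cont: "(\<lambda>j. P (p j) x) \<longlonglongrightarrow> P p' x" if "p \<longlonglongrightarrow> p'" for p p' x
      unfolding P_def using that by (intro folded_integral_continuous[OF g] tendsto_intros)
    have P_lim: "(\<lambda>n. truncated (E n) g (fst p) (snd p) x) \<longlonglongrightarrow> P p x" for p x
      unfolding P_def
    proof (rule truncated_tendsto[OF g, where \<epsilon> = "\<lambda>n. inverse (real (Suc (Suc n)))"])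
      fix t :: real assume "0 < t"
      have "(\<lambda>n. inverse (real (Suc (Suc n)))) \<longlonglongrightarrow> 0"
        by (rule LIMSEQ_Suc[OF LIMSEQ_inverse_real_of_nat])
      from order_tendstoD(2)[OF this \<open>0 < t\<close>]
      have "eventually (\<lambda>n. inverse (real (Suc (Suc n))) < t) sequentially" .
      moreover have "eventually (\<lambda>n. t \<le> real n) sequentially"
        using filterlim_real_sequentially by (simp add: filterlim_at_top)
      ultimately show "eventually (\<lambda>n. t \<in> E n) sequentially"
        by eventually_elim (use \<open>0 < t\<close> in \<open>auto simp: E_def\<close>)
    qed (auto simp: E_def)
    \<comment> \<open>By continuity in the frequencies, bounds on the dense sequence extend to all frequencies.\<close>
    have le_of_dense: "ennreal (norm (P p x)) \<le> u" if "\<And>k. ennreal (norm (P (q k) x)) \<le> u" for p x u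
    proof -
      obtain r where "(\<lambda>j. q (r j)) \<longlonglongrightarrow> p" using q by blast
      then have "(\<lambda>j. ennreal (norm (P (q (r j)) x))) \<longlonglongrightarrow> ennreal (norm (P p x))"
        by (intro tendsto_intros P_cont)
      then show ?thesis by (rule LIMSEQ_le_const2) (use that in blast)
    qed
    have carleson_dense: "carleson_quad g x = (SUP k. ennreal (norm (P (q k) x)))" for x
      unfolding carleson
    proof (rule antisym)
      show "(SUP p. ennreal (norm (P p x))) \<le> (SUP k. ennreal (norm (P (q k) x)))"
        by (rule SUP_least, rule le_of_dense) (rule SUP_upper, simp)
      show "(SUP k. ennreal (norm (P (q k) x))) \<le> (SUP p. ennreal (norm (P p x)))"
        by (intro SUP_least SUP_upper) simp
    qed
    have T_meas: "(\<lambda>x. truncated (E n) g (fst (p x)) (snd (p x)) x) \<in> borel_measurable borel"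
      if [measurable]: "p \<in> borel_measurable borel" for n p
      by (rule truncated_measurable[OF g]) simp_all
    have [measurable]: "P p \<in> borel_measurable borel" for p
      using T_meas[of "\<lambda>_. p"] by (intro borel_measurable_LIMSEQ_metric[OF _ P_lim]) simp_all
    have meas: "carleson_quad g \<in> borel_measurable borel"
      unfolding carleson_dense[abs_def] by measurable
    have "\<exists>p \<in> borel_measurable borel. \<forall>x. \<forall>k\<le>n.
        norm (truncated (E n) g (fst (q k)) (snd (q k)) x) \<le> norm (truncated (E n) g (fst (p x)) (snd (p x)) x)" for n
      by (rule measurable_maximizer[where T = "\<lambda>p x. norm (truncated (E n) g (fst p) (snd p) x)"])
         (rule measurable_compose[OF T_meas borel_measurable_norm])
    then obtain p where p [measurable]: "\<And>n. p n \<in> borel_measurable borel"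
      and p_max: "\<And>n x k. k \<le> n \<Longrightarrow> norm (truncated (E n) g (fst (q k)) (snd (q k)) x)
          \<le> norm (truncated (E n) g (fst (p n x)) (snd (p n x)) x)"
      by metis
    define v where "v n x = ennreal (norm (truncated (E n) g (fst (p n x)) (snd (p n x)) x))" for n x
    have [measurable]: "v n \<in> borel_measurable borel" for n
      unfolding v_def using T_meas[OF p] by simp
    have v_bound: "(\<integral>\<^sup>+ x. (v n x)\<^sup>2 \<partial>lborel) \<le> C\<^sup>2 * (\<integral>\<^sup>+ x. (ennreal (norm (g x)))\<^sup>2 \<partial>lborel)" for n
    proof -
      have "inverse (real (Suc (Suc n))) < real (Suc n)"
        by (rule less_le_trans[of _ 1]) (auto simp: inverse_less_1_iff)
      then have "cL2norm (\<lambda>x. truncated (E n) g (fst (p n x)) (snd (p n x)) x) \<le> C * cL2norm g"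
        by (intro truncated_L2_bound[where \<epsilon> = "inverse (real (Suc (Suc n)))"] g)
           (auto simp: E_def intro!: bound)
      then show ?thesis by (simp add: L2norm_le_iff v_def)
    qed
    \<comment> \<open>Each \<open>q k\<close> takes part in the maximum defining \<open>v n\<close> as soon as \<open>n \<ge> k\<close>.\<close>
    have "carleson_quad g x \<le> liminf (\<lambda>n. v n x)" for x
      unfolding carleson
    proof (rule SUP_least, rule le_of_dense)
      fix k
      have "(\<lambda>n. ennreal (norm (truncated (E n) g (fst (q k)) (snd (q k)) x))) \<longlonglongrightarrow> ennreal (norm (P (q k) x))"
        by (intro tendsto_intros P_lim)
      from lim_imp_Liminf[OF _ this, symmetric]
      have "ennreal (norm (P (q k) x)) = liminf (\<lambda>n. ennreal (norm (truncated (E n) g (fst (q k)) (snd (q k)) x)))" by simp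
      also have "\<dots> \<le> liminf (\<lambda>n. v n x)"
        by (rule Liminf_mono) (auto simp: v_def p_max eventually_sequentially intro!: exI[of _ k] ennreal_leI)
      finally show "ennreal (norm (P (q k) x)) \<le> liminf (\<lambda>n. v n x)" .
    qed
    then have "(\<integral>\<^sup>+ x. (carleson_quad g x)\<^sup>2 \<partial>lborel) \<le> (\<integral>\<^sup>+ x. liminf (\<lambda>n. (v n x)\<^sup>2) \<partial>lborel)"
      unfolding liminf_power2_ennreal by (intro nn_integral_mono power_mono) auto
    also have "\<dots> \<le> liminf (\<lambda>n. \<integral>\<^sup>+ x. (v n x)\<^sup>2 \<partial>lborel)"
      by (rule nn_integral_liminf) simp
    also have "\<dots> \<le> C\<^sup>2 * (\<integral>\<^sup>+ x. (ennreal (norm (g x)))\<^sup>2 \<partial>lborel)"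
      by (rule Liminf_le) (use v_bound in simp_all)
    finally show ?thesis using meas by (simp add: L2norm_le_iff)
  qed
  then show ?thesis using C unfolding bounded_on_L2_def by blast
qed

end
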